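(* Suppose that $1<p<\infty$ and let $\mu$ be a finite positive Borel measure on $[0,1)$ such that the operator $\mathcal H_\mu$ is bounded from $B^p$ to itself. Then $\mu$ is a $\gamma$-logarithmic $1$-Carleson measure for any $\gamma$ with $0\le\gamma<1-\frac1p$.
   Context: $\mathbb D=\{z\in\mathbb C:|z|<1\}$, and $dA(z)=\frac{dx\,dy}{\pi}$. For $1<p<\infty$ the analytic Besov space $B^p$ is the set of analytic functions $f$ in $\mathbb D$ with $\|f\|_{B^p}=\left(|f(0)|^p+\rho_p(f)^p\right)^{1/p}<\infty$, where $\rho_p(f)=\left(\int_{\mathbb D}(1-|z|^2)^{p-2}|f'(z)|^p\,dA(z)\right)^{1/p}$. For $\alpha\ge0$ and $s>0$, a positive Borel measure $\mu$ on $[0,1)$ is an $\alpha$-logarithmic $s$-Carleson measure if there is $C>0$ with $\mu([t,1))\left(\log\frac{2}{1-t}\right)^\alpha\le C(1-t)^s$ for all $0\le t<1$. For a finite positive Borel measure $\mu$ on $[0,1)$, $\mu_n=\int_{[0,1)}t^n\,d\mu(t)$, and for $f(z)=\sum_{k\ge0}a_kz^k$ analytic in $\mathbb D$, $$\mathcal H_\mu(f)(z)=\sum_{n=0}^\infty\Big(\sum_{k=0}^\infty\mu_{n+k}a_k\Big)z^n,$$ whenever the right-hand side makes sense and defines an analytic function in $\mathbb D$; boundedness of $\mathcal H_\mu$ on a space includes that it is well defined for every $f$ in the space. *)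

theory Defs
  imports "HOL-Analysis.Analysis"
begin

abbreviation unit_disc :: "complex set" where
  "unit_disc \<equiv> ball 0 1"

definition besov_density :: "real \<Rightarrow> (complex \<Rightarrow> complex) \<Rightarrow> complex \<Rightarrow> real" where
  "besov_density p f z = (1 - (cmod z)\<^sup>2) powr (p - 2) * cmod (deriv f z) powr p"

text \<open>The area measure is normalised to be \<open>dx dy / pi\<close>, whence the factor \<open>1 / pi\<close>.\<close>

definition besov_rho :: "real \<Rightarrow> (complex \<Rightarrow> complex) \<Rightarrow> real" where
  "besov_rho p f = (1 / pi * (LINT z:unit_disc|lborel. besov_density p f z)) powr (1 / p)"

definition besov_norm :: "real \<Rightarrow> (complex \<Rightarrow> complex) \<Rightarrow> real" where
  "besov_norm p f = (cmod (f 0) powr p + besov_rho p f powr p) powr (1 / p)"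

text \<open>
  The norm above is real-valued, and is \<open>cmod (f 0)\<close> when the integral diverges. The condition
  that the norm is finite is therefore expressed by integrability of the (nonnegative) density.
  Elements of the space are total functions of which only the restriction to the disc matters.
\<close>

definition besov_space :: "real \<Rightarrow> (complex \<Rightarrow> complex) set" where
  "besov_space p = {f. f holomorphic_on unit_disc \<and> set_integrable lborel unit_disc (besov_density p f)}"

definition borel_measure_01 :: "real measure \<Rightarrow> bool" where
  "borel_measure_01 \<mu> \<longleftrightarrow> sets \<mu> = sets (restrict_space borel {0..<1})"

text \<open>Stated with \<^const>\<open>emeasure\<close>, so that an infinite measure is not mistaken for a null one.\<close>

definition log_carleson :: "real \<Rightarrow> real \<Rightarrow> real measure \<Rightarrow> bool" where
  "log_carleson \<alpha> s \<mu> \<longleftrightarrow> borel_measure_01 \<mu> \<and>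
     (\<exists>C>0. \<forall>t\<in>{0..<1}.
        emeasure \<mu> {t..<1} * ennreal (ln (2 / (1 - t)) powr \<alpha>) \<le> ennreal (C * (1 - t) powr s))"

definition moment :: "real measure \<Rightarrow> nat \<Rightarrow> real" where
  "moment \<mu> n = (LINT t|\<mu>. t ^ n)"

definition taylor_coeff :: "(complex \<Rightarrow> complex) \<Rightarrow> nat \<Rightarrow> complex" where
  "taylor_coeff f k = (deriv ^^ k) f 0 / fact k"

definition hankel_coeff :: "real measure \<Rightarrow> (complex \<Rightarrow> complex) \<Rightarrow> nat \<Rightarrow> complex" where
  "hankel_coeff \<mu> f n = (\<Sum>k. of_real (moment \<mu> (n + k)) * taylor_coeff f k)"

definition hankel_op :: "real measure \<Rightarrow> (complex \<Rightarrow> complex) \<Rightarrow> complex \<Rightarrow> complex" where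
  "hankel_op \<mu> f z = (\<Sum>n. hankel_coeff \<mu> f n * z ^ n)"

text \<open>
  All series are understood as ordinary (possibly only conditionally) convergent ones.
\<close>

definition hankel_well_defined :: "real measure \<Rightarrow> (complex \<Rightarrow> complex) \<Rightarrow> bool" where
  "hankel_well_defined \<mu> f \<longleftrightarrow>
     (\<forall>n. summable (\<lambda>k. of_real (moment \<mu> (n + k)) * taylor_coeff f k)) \<and>
     (\<forall>z\<in>unit_disc. summable (\<lambda>n. hankel_coeff \<mu> f n * z ^ n)) \<and>
     hankel_op \<mu> f holomorphic_on unit_disc"

definition hankel_bounded_besov :: "real \<Rightarrow> real measure \<Rightarrow> bool" where
  "hankel_bounded_besov p \<mu> \<longleftrightarrow>
     (\<forall>f\<in>besov_space p. hankel_well_defined \<mu> f \<and> hankel_op \<mu> f \<in> besov_space p) \<and>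
     (\<exists>C. \<forall>f\<in>besov_space p. besov_norm p (hankel_op \<mu> f) \<le> C * besov_norm p f)"

end

theory Submission
  imports Defs
begin

text \<open>
  The operator is tested on the functions \<open>f z = - Ln (1 - b z)\<close>, where \<open>b\<close> in \<open>[0, 1)\<close> tends to 1. Put
  \<open>\<delta> = 1 - b\<close>, \<open>L = ln (2 / \<delta>)\<close>, and let \<open>m\<close> be the mass that \<open>\<mu>\<close> gives to \<open>[b, 1)\<close>.

  These functions are small in the space: \<open>\<bar>f'\<bar> \<le> 1 / \<bar>1 - b z\<bar>\<close>, and the integral of
  \<open>(1 - \<bar>z\<bar>\<^sup>2) powr (p - 2) / \<bar>1 - b z\<bar> powr p\<close> over the disc is \<open>O(L)\<close>, so that the norm of \<open>f\<close> is
  \<open>O(L powr (1 / p))\<close> (\<open>nn_integral_kernel_density_le\<close>, \<open>log_kernel_besov\<close>). The integral is estimated in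
  Cartesian coordinates, since on each horizontal chord a majorant of the integrand has an elementary
  primitive.

  Their images are large: the derivative of the image of \<open>f\<close> at \<open>z\<close> is the integral of
  \<open>t f(t) / (1 - t z)\<^sup>2\<close> with respect to \<open>\<mu>\<close> (\<open>hankel_op_log_kernel_deriv\<close>). If \<open>z\<close> runs through a box of
  side \<open>\<delta> / 2\<close> next to \<open>b\<close>, contained in a narrow sector with vertex 1, then all these integrands have
  nonnegative real part, and those with \<open>t \<ge> b\<close> have real part at least a multiple of
  \<open>L / \<delta>\<^sup>2\<close>. Hence the derivative is at least a multiple of \<open>L m / \<delta>\<^sup>2\<close> on the whole box
  (\<open>hankel_op_log_kernel_deriv_ge\<close>). Since the box has area \<open>\<delta>\<^sup>2 / 4\<close> and the weight is of order
  \<open>\<delta> powr (p - 2)\<close> on it, the norm of the image is at least a multiple of \<open>L m / \<delta>\<close>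
  (\<open>besov_norm_ge_of_deriv_ge_on_box\<close>).

  Boundedness therefore gives \<open>L m / \<delta> \<le> D * L powr (1 / p)\<close>, that is
  \<open>m * L powr (1 - 1 / p) \<le> D * \<delta>\<close>, for some constant \<open>D\<close> independent of \<open>b\<close>
  (\<open>hankel_bounded_besov_log_growth\<close>). As \<open>L \<ge> 1\<close> for \<open>b\<close> close to 1, the power of \<open>L\<close> may be lowered to
  \<open>\<gamma>\<close>; for the remaining \<open>b\<close> the finiteness of \<open>\<mu>\<close> suffices.
\<close>

section \<open>Iterated integration over the complex plane\<close>

lemma lborel_complex_eq_distr:
  "(lborel :: complex measure) = distr (lborel \<Otimes>\<^sub>M lborel) borel (\<lambda>(x, y). Complex x y)"
proof (rule lborel_eqI)
  have [measurable]: "(\<lambda>(x, y). Complex x y) \<in> borel_measurable (lborel \<Otimes>\<^sub>M lborel)"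
    unfolding Complex_eq by simp
  fix l u :: complex
  assume le: "\<And>b. b \<in> Basis \<Longrightarrow> l \<bullet> b \<le> u \<bullet> b"
  have re: "Re l \<le> Re u" and im: "Im l \<le> Im u"
    using le[of 1] le[of \<i>] by (auto simp: Basis_complex_def)
  have "(\<lambda>(x, y). Complex x y) -` box l u \<inter> space (lborel \<Otimes>\<^sub>M lborel) =
      {Re l<..<Re u} \<times> {Im l<..<Im u}"
    by (auto simp: box_def Basis_complex_def space_pair_measure)
  then have "emeasure (distr (lborel \<Otimes>\<^sub>M lborel) borel (\<lambda>(x, y). Complex x y)) (box l u)
      = emeasure lborel {Re l<..<Re u} * emeasure lborel {Im l<..<Im u}"
    by (simp add: emeasure_distr lborel.emeasure_pair_measure_Times)
  also have "\<dots> = ennreal ((Re u - Re l) * (Im u - Im l))"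
    using re im by (simp add: ennreal_mult')
  also have "(Re u - Re l) * (Im u - Im l) = (\<Prod>b\<in>Basis. (u - l) \<bullet> b)"
    by (simp add: Basis_complex_def)
  finally show "emeasure (distr (lborel \<Otimes>\<^sub>M lborel) borel (\<lambda>(x, y). Complex x y)) (box l u)
      = ennreal (\<Prod>b\<in>Basis. (u - l) \<bullet> b)" .
qed simp

lemma nn_integral_complex_iterated:
  assumes [measurable]: "f \<in> borel_measurable (borel :: complex measure)"
  shows "(\<integral>\<^sup>+z. f z \<partial>lborel) = (\<integral>\<^sup>+y. \<integral>\<^sup>+x. f (Complex x y) \<partial>lborel \<partial>lborel)"
proof -
  have [measurable]: "(\<lambda>(x, y). Complex x y) \<in> borel_measurable (lborel \<Otimes>\<^sub>M lborel)"
    unfolding Complex_eq by simp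
  have "(\<integral>\<^sup>+z. f z \<partial>lborel) = (\<integral>\<^sup>+(x, y). f (Complex x y) \<partial>(lborel \<Otimes>\<^sub>M lborel))"
    by (subst lborel_complex_eq_distr, subst nn_integral_distr)
       (auto simp: case_prod_beta' intro!: nn_integral_cong)
  also have "\<dots> = (\<integral>\<^sup>+y. \<integral>\<^sup>+x. f (Complex x y) \<partial>lborel \<partial>lborel)"
  proof (subst lborel_pair.nn_integral_snd[symmetric])
    have "(\<lambda>p. f ((\<lambda>(x, y). Complex x y) p)) \<in> borel_measurable (lborel \<Otimes>\<^sub>M lborel)"
      by measurable
    then show "(\<lambda>(x, y). f (Complex x y)) \<in> borel_measurable (lborel \<Otimes>\<^sub>M lborel)"
      by (simp add: case_prod_beta)
  qed simp
  finally show ?thesis .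
qed

section \<open>A logarithmic bound for a weighted kernel integral over the disc\<close>

text \<open>
  The kernel integral is computed along horizontal chords: on the chord at height \<open>y\<close>, whose half
  length is \<open>s = sqrt (1 - y\<^sup>2)\<close>, the variable \<open>u = s - \<bar>x\<bar>\<close> is the horizontal distance to the circle.
  The integrand has an elementary primitive because \<open>u / (w + u)\<close> has derivative
  \<open>w / (w + u)\<^sup>2\<close>. The exponents sum to \<open>-2\<close>, so that the value depends on \<open>s\<close> only
  through a factor at most 1, and is of order \<open>1 / w\<close>. The primitive is continuous up to \<open>u = 0\<close> as
  \<open>q + 1 > 0\<close>, which takes care of the singularity of \<open>u powr q\<close> when \<open>q < 0\<close>.
\<close>
lemma has_integral_chord_kernel:
  fixes q w s :: real
  assumes q: "q > -1" and w: "w > 0" and s: "s \<ge> 0"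
  shows "((\<lambda>x. (s - \<bar>x\<bar>) powr q * (w + (s - \<bar>x\<bar>)) powr (- (q + 2))) has_integral
           2 * (s / (w + s)) powr (q + 1) / ((q + 1) * w)) {-s..s}"
proof -
  let ?k = "\<lambda>u. u powr q * (w + u) powr (- (q + 2))"
  let ?F = "\<lambda>u. (u / (w + u)) powr (q + 1) / ((q + 1) * w)"
  have "(?k has_integral (?F s - ?F 0)) {0..s}"
  proof (rule fundamental_theorem_of_calculus_interior[OF s])
    show "continuous_on {0..s} ?F"
      using q w by (intro continuous_intros continuous_on_powr') auto
    fix u assume u: "u \<in> {0<..<s}"
    have d: "((\<lambda>u. u / (w + u)) has_real_derivative w / (w + u)\<^sup>2) (at u)"
      using u w by (auto intro!: derivative_eq_intros simp: power2_eq_square field_simps)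
    have "(?F has_real_derivative
        (q + 1) * (u / (w + u)) powr (q + 1 - 1) * (w / (w + u)\<^sup>2) / ((q + 1) * w)) (at u)"
      using u w by (intro DERIV_cdivide DERIV_chain2[OF has_real_derivative_powr d]) auto
    also have "(q + 1) * (u / (w + u)) powr (q + 1 - 1) * (w / (w + u)\<^sup>2) / ((q + 1) * w)
        = (u / (w + u)) powr q / (w + u)\<^sup>2"
      using q w by simp
    also have "\<dots> = ?k u"
      using u w by (simp add: powr_divide powr_diff powr_minus powr_add field_simps)
    finally show "(?F has_vector_derivative ?k u) (at u)"
      by (simp add: has_real_derivative_iff_has_vector_derivative)
  qed
  then have k: "(?k has_integral ?F s) {0..s}"
    using q by simp
  have "((\<lambda>x. ?k (s - x)) has_integral ?F s) {0..s}"
    using has_integral_affinity[of ?k "?F s" 0 s "-1" s] k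
    by (simp add: algebra_simps cbox_interval image_affinity_atLeastAtMost_diff)
  then have right: "((\<lambda>x. ?k (s - \<bar>x\<bar>)) has_integral ?F s) {0..s}"
    by (rule has_integral_eq[rotated]) auto
  then have "((\<lambda>x. ?k (s - \<bar>-x\<bar>)) has_integral ?F s) {-s..-0}"
    by (subst has_integral_reflect_real)
  then have left: "((\<lambda>x. ?k (s - \<bar>x\<bar>)) has_integral ?F s) {-s..0}"
    by simp
  show ?thesis
    using has_integral_combine[OF _ _ left right] s by (simp add: mult.commute)
qed

lemma has_integral_arcsin_deriv:
  "((\<lambda>y. 1 / sqrt (1 - y\<^sup>2)) has_integral pi) {-1..1}"
proof -
  have "((\<lambda>y. 1 / sqrt (1 - y\<^sup>2)) has_integral (arcsin 1 - arcsin (-1))) {-1..1}"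
  proof (rule fundamental_theorem_of_calculus_interior)
    show "continuous_on {-1..1} arcsin" by (rule continuous_on_arcsin')
    fix y :: real assume "y \<in> {-1<..<1}"
    then have "DERIV arcsin y :> inverse (sqrt (1 - y\<^sup>2))"
      by (intro DERIV_arcsin) auto
    then show "(arcsin has_vector_derivative 1 / sqrt (1 - y\<^sup>2)) (at y)"
      by (simp add: has_real_derivative_iff_has_vector_derivative inverse_eq_divide)
  qed simp
  then show ?thesis by simp
qed

lemma has_integral_inverse_shifted_abs:
  fixes \<delta> :: real assumes "\<delta> > 0"
  shows "((\<lambda>y. 1 / (\<delta> + \<bar>y\<bar>)) has_integral 2 * ln ((1 + \<delta>) / \<delta>)) {-1..1}"
proof -
  have "((\<lambda>y. 1 / (\<delta> + y)) has_integral (ln (\<delta> + 1) - ln (\<delta> + 0))) {0..1}"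
    using assms
    by (intro fundamental_theorem_of_calculus)
       (auto intro!: derivative_eq_intros simp flip: has_real_derivative_iff_has_vector_derivative)
  then have right: "((\<lambda>y. 1 / (\<delta> + \<bar>y\<bar>)) has_integral ln ((1 + \<delta>) / \<delta>)) {0..1}"
    using assms by (subst has_integral_cong[of _ _ "\<lambda>y. 1 / (\<delta> + y)"]) (simp_all add: ln_div add.commute[of 1])
  then have "((\<lambda>y. 1 / (\<delta> + \<bar>-y\<bar>)) has_integral ln ((1 + \<delta>) / \<delta>)) {-1..-0}"
    by (subst has_integral_reflect_real)
  then have left: "((\<lambda>y. 1 / (\<delta> + \<bar>y\<bar>)) has_integral ln ((1 + \<delta>) / \<delta>)) {-1..0}"
    by simp
  show ?thesis
    using has_integral_combine[OF _ _ left right] by simp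
qed

text \<open>
  The two singular factors are never small together: \<open>s = sqrt (1 - y\<^sup>2)\<close> is at least \<open>1 / 2\<close> when
  \<open>\<bar>y\<bar> \<le> 1 / 2\<close>, and \<open>\<delta> + \<bar>y\<bar>\<close> is at least \<open>1 / 2\<close> otherwise. Hence their product may be replaced by a
  sum of two functions with explicit primitives, and only one of them grows, logarithmically, as \<open>\<delta>\<close>
  tends to 0.
\<close>
lemma nn_integral_chord_weight_le:
  fixes \<delta> :: real assumes \<delta>: "\<delta> > 0"
  shows "(\<integral>\<^sup>+y\<in>{-1..1}. ennreal (1 / (sqrt (1 - y\<^sup>2) * (\<delta> + \<bar>y\<bar>))) \<partial>lborel)
      \<le> ennreal (4 * ln ((1 + \<delta>) / \<delta>) + 2 * pi)"
proof -
  have *: "((\<lambda>y. 2 * (1 / (\<delta> + \<bar>y\<bar>)) + 2 * (1 / sqrt (1 - y\<^sup>2))) has_integral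
      2 * (2 * ln ((1 + \<delta>) / \<delta>)) + 2 * pi) {-1..1}"
    by (intro has_integral_add has_integral_mult_right has_integral_arcsin_deriv
        has_integral_inverse_shifted_abs \<delta>)
  have pw: "1 / (sqrt (1 - y\<^sup>2) * (\<delta> + \<bar>y\<bar>)) \<le> 2 * (1 / (\<delta> + \<bar>y\<bar>)) + 2 * (1 / sqrt (1 - y\<^sup>2))"
    if y: "y \<in> {-1..1}" for y
  proof -
    define s w where "s = sqrt (1 - y\<^sup>2)" and "w = \<delta> + \<bar>y\<bar>"
    have y2: "y\<^sup>2 \<le> 1" using y by (simp add: abs_square_le_1 abs_le_iff)
    have s0: "s \<ge> 0" and s2: "s\<^sup>2 = 1 - y\<^sup>2" using y2 by (auto simp: s_def)
    have w0: "w > 0" using \<delta> by (simp add: w_def)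
    consider "s = 0" | "s > 0" "\<bar>y\<bar> \<le> 1/2" | "s > 0" "\<bar>y\<bar> > 1/2" using s0 by fastforce
    then have "1 / (s * w) \<le> 2 * (1 / w) + 2 * (1 / s)"
    proof cases
      case 1 then show ?thesis using w0 by simp
    next
      case 2
      have "(1/2)\<^sup>2 \<le> s\<^sup>2"
        using power_mono[OF 2(2), of 2] unfolding s2 by (simp add: power2_eq_square)
      then have "1/2 \<le> s" using s0 by (rule power2_le_imp_le)
      then have "1 / s \<le> 2" using 2 by (simp add: field_simps)
      then have "1 / s * (1 / w) \<le> 2 * (1 / w)" using w0 by (intro mult_right_mono) auto
      moreover have "2 * (1 / s) \<ge> 0" using s0 by simp
      ultimately show ?thesis by (simp add: add_increasing2)
    next
      case 3
      have "1 / w \<le> 2" using 3 w0 \<delta> by (simp add: field_simps w_def)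
      then have "1 / w * (1 / s) \<le> 2 * (1 / s)" using s0 by (intro mult_right_mono) auto
      moreover have "2 * (1 / w) \<ge> 0" using w0 by simp
      ultimately show ?thesis by (simp add: mult.commute add_increasing)
    qed
    then show ?thesis by (simp add: s_def w_def)
  qed
  have "(\<integral>\<^sup>+y\<in>{-1..1}. ennreal (1 / (sqrt (1 - y\<^sup>2) * (\<delta> + \<bar>y\<bar>))) \<partial>lborel)
      \<le> (\<integral>\<^sup>+y\<in>{-1..1}. ennreal (2 * (1 / (\<delta> + \<bar>y\<bar>)) + 2 * (1 / sqrt (1 - y\<^sup>2))) \<partial>lborel)"
    using pw by (intro nn_integral_mono) (simp add: indicator_def ennreal_leI)
  also have "\<dots> = ennreal (2 * (2 * ln ((1 + \<delta>) / \<delta>)) + 2 * pi)"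
  proof (intro nn_integral_has_integral_lebesgue' *)
    fix y :: real assume "y \<in> {-1..1}"
    then have "y\<^sup>2 \<le> 1" by (simp add: abs_square_le_1 abs_le_iff)
    then show "0 \<le> 2 * (1 / (\<delta> + \<bar>y\<bar>)) + 2 * (1 / sqrt (1 - y\<^sup>2))"
      using \<delta> by simp
  qed
  finally show ?thesis by simp
qed

text \<open>
  \<open>1 - b z\<close> has modulus at least \<open>1 - b\<close>, hence at least half of \<open>\<bar>1 - z\<bar>\<close>; and \<open>\<bar>1 - z\<bar>\<close> dominates both
  \<open>\<bar>Im z\<bar>\<close> and the horizontal distance from \<open>z\<close> to the circle.
\<close>
lemma cmod_one_minus_mult_ge:
  fixes b :: real and z :: complex
  assumes b: "0 \<le> b" "b < 1" and z: "cmod z < 1"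
  shows "1 - b + \<bar>Im z\<bar> + (sqrt (1 - (Im z)\<^sup>2) - \<bar>Re z\<bar>) \<le> 5 * cmod (1 - of_real b * z)"
proof -
  let ?d = "cmod (1 - of_real b * z)"
  have "b * cmod z \<le> b" using mult_left_mono[of "cmod z" 1 b] b z by simp
  then have 1: "1 - b \<le> ?d"
    using norm_triangle_ineq2[of 1 "of_real b * z"] b by (simp add: norm_mult)
  have "cmod (1 - z) \<le> ?d + cmod (of_real (1 - b) * z)"
    using norm_triangle_ineq4[of "1 - of_real b * z" "of_real (1 - b) * z"]
    by (simp add: algebra_simps)
  also have "cmod (of_real (1 - b) * z) \<le> 1 - b"
    using mult_left_mono[of "cmod z" 1 "1 - b"] b z by (simp add: norm_mult del: of_real_diff)
  finally have 2: "cmod (1 - z) \<le> 2 * ?d" using 1 by simp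
  have 3: "\<bar>Im z\<bar> \<le> cmod (1 - z)" using abs_Im_le_cmod[of "1 - z"] by simp
  have 4: "1 - Re z \<le> cmod (1 - z)" using complex_Re_le_cmod[of "1 - z"] by simp
  have "sqrt (1 - (Im z)\<^sup>2) \<le> 1" by simp
  then have "sqrt (1 - (Im z)\<^sup>2) - \<bar>Re z\<bar> \<le> 1 - Re z" by linarith
  with 1 2 3 4 show ?thesis by linarith
qed

text \<open>
  On the chord through \<open>z\<close> one has \<open>1 - \<bar>z\<bar>\<^sup>2 = s\<^sup>2 - \<bar>Re z\<bar>\<^sup>2 = u (s + \<bar>Re z\<bar>)\<close> with \<open>u = s - \<bar>Re z\<bar>\<close>. The
  factor \<open>u\<close> is kept for the integration along the chord. The other one lies between \<open>s\<close> and \<open>2\<close>,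
  so its power is at most \<open>2 powr \<bar>q\<bar> / s\<close>, whether \<open>q\<close> is negative or not; this costs only an
  integrable singularity in \<open>y\<close>.
\<close>
lemma kernel_density_le:
  fixes b q :: real and z :: complex
  assumes b: "0 \<le> b" "b < 1" and q: "q > -1" and z: "cmod z < 1"
  defines "s \<equiv> sqrt (1 - (Im z)\<^sup>2)" and "w \<equiv> 1 - b + \<bar>Im z\<bar>"
  shows "\<bar>Re z\<bar> < s"
    and "(1 - (cmod z)\<^sup>2) powr q * cmod (1 - of_real b * z) powr (- (q + 2))
      \<le> 2 powr \<bar>q\<bar> * 5 powr (q + 2) * (1 / s) *
          ((s - \<bar>Re z\<bar>) powr q * (w + (s - \<bar>Re z\<bar>)) powr (- (q + 2)))"
proof -
  have z2: "(Re z)\<^sup>2 + (Im z)\<^sup>2 < 1"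
    using z by (metis cmod_power2 norm_ge_zero power_less_one_iff zero_less_numeral abs_square_less_1 abs_norm_cancel)
  then have y2: "(Im z)\<^sup>2 < 1" by (smt (verit) zero_le_power2)
  have s2: "s\<^sup>2 = 1 - (Im z)\<^sup>2" and s0: "s > 0" using y2 by (auto simp: s_def)
  have s1: "s \<le> 1" by (simp add: s_def)
  show xs: "\<bar>Re z\<bar> < s"
  proof (rule power2_less_imp_less)
    show "\<bar>Re z\<bar>\<^sup>2 < s\<^sup>2" using z2 s2 by simp
  qed (use s0 in auto)
  define u where "u = s - \<bar>Re z\<bar>"
  have u: "u > 0" using xs by (simp add: u_def)
  have w: "w > 0" using b by (simp add: w_def)
  have "1 - (cmod z)\<^sup>2 = s\<^sup>2 - \<bar>Re z\<bar>\<^sup>2" by (simp add: cmod_power2 s2)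
  then have fac: "1 - (cmod z)\<^sup>2 = u * (s + \<bar>Re z\<bar>)"
    by (simp add: u_def power2_eq_square algebra_simps)
  have A: "(s + \<bar>Re z\<bar>) powr q \<le> 2 powr \<bar>q\<bar> * (1 / s)"
  proof (cases "q \<ge> 0")
    case True
    have "(s + \<bar>Re z\<bar>) powr q \<le> 2 powr q" using True s0 s1 xs by (intro powr_mono2) auto
    also have "\<dots> \<le> 2 powr q * (1 / s)" using s0 s1 by (simp add: field_simps)
    finally show ?thesis using True by simp
  next
    case False
    have "(s + \<bar>Re z\<bar>) powr q \<le> s powr q" using False s0 by (intro powr_mono2') auto
    also have "\<dots> \<le> s powr (-1)" using q s0 s1 by (intro powr_mono') auto
    also have "\<dots> = 1 / s" using s0 by (simp add: powr_minus_divide)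
    also have "\<dots> \<le> 2 powr \<bar>q\<bar> * (1 / s)"
      using s0 mult_right_mono[OF ge_one_powr_ge_zero[of 2 "\<bar>q\<bar>"], of "1 / s"] by simp
    finally show ?thesis .
  qed
  have "(w + u) / 5 \<le> cmod (1 - of_real b * z)"
    using cmod_one_minus_mult_ge[OF b z] by (simp add: w_def u_def s_def)
  then have "cmod (1 - of_real b * z) powr (- (q + 2)) \<le> ((w + u) / 5) powr (- (q + 2))"
    using q w u by (intro powr_mono2') auto
  also have "\<dots> = 5 powr (q + 2) * (w + u) powr (- (q + 2))"
    using w u by (simp add: powr_divide powr_minus_divide del: minus_add_distrib)
  finally have B: "cmod (1 - of_real b * z) powr (- (q + 2))
      \<le> 5 powr (q + 2) * (w + u) powr (- (q + 2))" .
  have "(1 - (cmod z)\<^sup>2) powr q * cmod (1 - of_real b * z) powr (- (q + 2))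
      = u powr q * ((s + \<bar>Re z\<bar>) powr q * cmod (1 - of_real b * z) powr (- (q + 2)))"
    unfolding fac using u s0 by (simp add: powr_mult)
  also have "\<dots> \<le> u powr q * ((2 powr \<bar>q\<bar> * (1 / s)) * (5 powr (q + 2) * (w + u) powr (- (q + 2))))"
    using A B s0 by (intro mult_left_mono mult_mono) auto
  finally show "(1 - (cmod z)\<^sup>2) powr q * cmod (1 - of_real b * z) powr (- (q + 2))
      \<le> 2 powr \<bar>q\<bar> * 5 powr (q + 2) * (1 / s) *
          ((s - \<bar>Re z\<bar>) powr q * (w + (s - \<bar>Re z\<bar>)) powr (- (q + 2)))"
    by (simp add: u_def mult_ac)
qed

text \<open>
  Integrating the chord majorant over \<open>x\<close> leaves \<open>1 / (s w)\<close>, whose integral over \<open>y\<close> was bounded above.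
  The exponent \<open>- (q + 2)\<close> is the critical one: a larger power of \<open>1 / \<bar>1 - b z\<bar>\<close> would give a power of
  \<open>1 / (1 - b)\<close> in place of the logarithm.
\<close>
lemma nn_integral_kernel_density_le:
  fixes b q :: real
  assumes b: "0 \<le> b" "b < 1" and q: "q > -1"
  shows "(\<integral>\<^sup>+z\<in>unit_disc. ennreal ((1 - (cmod z)\<^sup>2) powr q *
             cmod (1 - of_real b * z) powr (- (q + 2))) \<partial>lborel)
      \<le> ennreal (2 powr \<bar>q\<bar> * 5 powr (q + 2) * (2 / (q + 1)) *
             (4 * ln ((2 - b) / (1 - b)) + 2 * pi))"
proof -
  define K where "K = 2 powr \<bar>q\<bar> * 5 powr (q + 2)"
  define f where "f = (\<lambda>z. (1 - (cmod z)\<^sup>2) powr q * cmod (1 - of_real b * z) powr (- (q + 2)))"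
  have K: "K \<ge> 0" by (simp add: K_def)
  have [measurable]: "f \<in> borel_measurable borel" unfolding f_def by measurable
  have inner: "(\<integral>\<^sup>+x. ennreal (f (Complex x y)) * indicator unit_disc (Complex x y) \<partial>lborel)
      \<le> ennreal (K * (2 / (q + 1))) *
          (ennreal (1 / (sqrt (1 - y\<^sup>2) * (1 - b + \<bar>y\<bar>))) * indicator {-1..1} y)" for y
  proof (cases "\<bar>y\<bar> < 1")
    case False
    then have "Complex x y \<notin> unit_disc" for x
      using abs_Im_le_cmod[of "Complex x y"] by auto
    then show ?thesis by simp
  next
    case True
    define s w where "s = sqrt (1 - y\<^sup>2)" and "w = 1 - b + \<bar>y\<bar>"
    have "y\<^sup>2 < 1" using True by (simp add: abs_square_less_1)
    then have s: "s > 0" by (simp add: s_def)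
    have w: "w > 0" using b by (simp add: w_def)
    let ?g = "\<lambda>x. (s - \<bar>x\<bar>) powr q * (w + (s - \<bar>x\<bar>)) powr (- (q + 2))"
    have "(\<integral>\<^sup>+x. ennreal (f (Complex x y)) * indicator unit_disc (Complex x y) \<partial>lborel)
        \<le> (\<integral>\<^sup>+x. ennreal (K * (1 / s)) * (ennreal (?g x) * indicator {-s..s} x) \<partial>lborel)"
    proof (rule nn_integral_mono)
      fix x
      show "ennreal (f (Complex x y)) * indicator unit_disc (Complex x y)
          \<le> ennreal (K * (1 / s)) * (ennreal (?g x) * indicator {-s..s} x)"
      proof (cases "Complex x y \<in> unit_disc")
        case True
        then have c: "cmod (Complex x y) < 1" by simp
        have "x \<in> {-s..s}" and "f (Complex x y) \<le> K * (1 / s) * ?g x"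
          using kernel_density_le[OF b q c] by (auto simp: s_def w_def f_def K_def)
        then have "ennreal (f (Complex x y)) \<le> ennreal (K * (1 / s)) * ennreal (?g x)"
          and "indicator {-s..s} x = (1 :: ennreal)" and "indicator unit_disc (Complex x y) = (1 :: ennreal)"
          using K s True by (auto simp: ennreal_leI simp flip: ennreal_mult')
        then show ?thesis by simp
      qed simp
    qed
    also have "\<dots> = ennreal (K * (1 / s)) * (\<integral>\<^sup>+x. ennreal (?g x) * indicator {-s..s} x \<partial>lborel)"
      by (intro nn_integral_cmult) measurable
    also have "(\<integral>\<^sup>+x. ennreal (?g x) * indicator {-s..s} x \<partial>lborel)
        = ennreal (2 * (s / (w + s)) powr (q + 1) / ((q + 1) * w))"
      using s by (intro nn_integral_has_integral_lebesgue' has_integral_chord_kernel q w) auto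
    also have "\<dots> \<le> ennreal (2 / ((q + 1) * w))"
    proof (intro ennreal_leI divide_right_mono)
      have "(s / (w + s)) powr (q + 1) \<le> 1"
        using s w q by (intro powr_le1) auto
      then show "2 * (s / (w + s)) powr (q + 1) \<le> 2" by simp
    qed (use q w in auto)
    also have "ennreal (K * (1 / s)) * \<dots> = ennreal (K * (2 / (q + 1))) * ennreal (1 / (s * w))"
      using K s w q by (simp flip: ennreal_mult' add: field_simps)
    finally show ?thesis
      using True by (simp add: mult_left_mono s_def w_def abs_less_iff)
  qed
  have "(\<integral>\<^sup>+z\<in>unit_disc. ennreal (f z) \<partial>lborel)
      = (\<integral>\<^sup>+y. \<integral>\<^sup>+x. ennreal (f (Complex x y)) * indicator unit_disc (Complex x y) \<partial>lborel \<partial>lborel)"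
    by (rule nn_integral_complex_iterated) (intro borel_measurable_times_ennreal borel_measurable_indicator; simp)
  also have "\<dots> \<le> (\<integral>\<^sup>+y. ennreal (K * (2 / (q + 1))) *
          (ennreal (1 / (sqrt (1 - y\<^sup>2) * (1 - b + \<bar>y\<bar>))) * indicator {-1..1} y) \<partial>lborel)"
    by (intro nn_integral_mono inner)
  also have "\<dots> = ennreal (K * (2 / (q + 1))) *
      (\<integral>\<^sup>+y\<in>{-1..1}. ennreal (1 / (sqrt (1 - y\<^sup>2) * (1 - b + \<bar>y\<bar>))) \<partial>lborel)"
    by (intro nn_integral_cmult) measurable
  also have "\<dots> \<le> ennreal (K * (2 / (q + 1))) *
      ennreal (4 * ln ((1 + (1 - b)) / (1 - b)) + 2 * pi)"
    using b by (intro mult_left_mono nn_integral_chord_weight_le) auto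
  also have "\<dots> = ennreal (K * (2 / (q + 1)) * (4 * ln ((2 - b) / (1 - b)) + 2 * pi))"
    using K q by (simp add: ennreal_mult' [symmetric])
  finally show ?thesis unfolding f_def K_def .
qed

section \<open>The logarithmic test functions\<close>

definition log_kernel :: "real \<Rightarrow> complex \<Rightarrow> complex" where
  "log_kernel b z = - Ln (1 - of_real b * z)"

lemma cmod_of_real_mult_less_one:
  assumes "0 \<le> b" "b < 1" "cmod z < 1"
  shows "cmod (of_real b * z) < 1"
  using mult_strict_mono'[of b 1 "cmod z" 1] assms by (simp add: norm_mult)

lemma has_field_derivative_log_kernel:
  assumes "0 \<le> b" "b < 1" "cmod z < 1"
  shows "(log_kernel b has_field_derivative of_real b / (1 - of_real b * z)) (at z)"
proof -
  have "Re (1 - of_real b * z) > 0"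
    using complex_Re_le_cmod[of "of_real b * z"] cmod_of_real_mult_less_one[OF assms] by simp
  then have "1 - of_real b * z \<notin> \<real>\<^sub>\<le>\<^sub>0"
    by (auto simp: complex_nonpos_Reals_iff)
  then show ?thesis
    unfolding log_kernel_def by (auto intro!: derivative_eq_intros simp: field_simps)
qed

lemma holomorphic_log_kernel:
  assumes "0 \<le> b" "b < 1" shows "log_kernel b holomorphic_on unit_disc"
  unfolding holomorphic_on_def field_differentiable_def
  using has_field_derivative_at_within[OF has_field_derivative_log_kernel[OF assms]]
  by fastforce

lemma taylor_coeff_log_kernel:
  assumes "0 \<le> b" "b < 1"
  shows "taylor_coeff (log_kernel b) k = of_real (b ^ k / real k)"
proof -
  let ?F = "Abs_fps (\<lambda>k. of_real (b ^ k / real k) :: complex)"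
  have "log_kernel b has_fps_expansion ?F"
  proof (rule has_fps_expansionI)
    have "eventually (\<lambda>z :: complex. z \<in> ball 0 1) (nhds 0)"
      by (intro eventually_nhds_in_open) auto
    then show "eventually (\<lambda>z. (\<lambda>n. fps_nth ?F n * z ^ n) sums log_kernel b z) (nhds 0)"
    proof eventually_elim
      case (elim z)
      then have "cmod (- (of_real b * z)) < 1"
        using cmod_of_real_mult_less_one[OF assms, of z] by simp
      from sums_minus[OF Ln_series'[OF this]] show ?case
        by (simp add: log_kernel_def power_mult_distrib)
    qed
  qed
  from fps_nth_fps_expansion[OF this, of k] show ?thesis
    by (simp add: taylor_coeff_def)
qed

lemma besov_density_log_kernel_le:
  assumes b: "0 \<le> b" "b < 1" and p: "1 < p" and z: "cmod z < 1"
  shows "besov_density p (log_kernel b) z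
      \<le> (1 - (cmod z)\<^sup>2) powr (p - 2) * cmod (1 - of_real b * z) powr (- (p - 2 + 2))"
proof -
  have d: "deriv (log_kernel b) z = of_real b / (1 - of_real b * z)"
    using has_field_derivative_log_kernel[OF b z] by (rule DERIV_imp_deriv)
  have "cmod (deriv (log_kernel b) z) powr p = b powr p * cmod (1 - of_real b * z) powr (- p)"
    using b by (simp add: d norm_divide powr_divide powr_minus_divide)
  also have "\<dots> \<le> 1 * cmod (1 - of_real b * z) powr (- p)"
    using b p by (intro mult_right_mono powr_le1) auto
  finally show ?thesis
    by (auto simp: besov_density_def intro: mult_left_mono)
qed

text \<open>
  The \<open>p\<close>-th power of the norm grows only like \<open>ln (1 / (1 - b))\<close>. On the other hand the function itself
  is that large at \<open>z = b\<close>; the gap between the exponents \<open>1 / p\<close> and 1 is what the test functions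
  exploit.
\<close>
lemma log_kernel_besov:
  assumes b: "0 \<le> b" "b < 1" and p: "1 < p"
  defines "E \<equiv> 2 powr \<bar>p - 2\<bar> * 5 powr p * (2 / (p - 1)) * (4 * ln ((2 - b) / (1 - b)) + 2 * pi)"
  shows "log_kernel b \<in> besov_space p" and "besov_norm p (log_kernel b) \<le> E powr (1 / p)"
proof -
  let ?d = "\<lambda>z. indicator unit_disc z *\<^sub>R besov_density p (log_kernel b) z"
  have "?d = (\<lambda>z. indicator unit_disc z *
      ((1 - (cmod z)\<^sup>2) powr (p - 2) * cmod (of_real b / (1 - of_real b * z)) powr p))"
    using DERIV_imp_deriv[OF has_field_derivative_log_kernel[OF b]]
    by (auto simp: fun_eq_iff besov_density_def indicator_def)
  moreover have "(\<lambda>z. indicat_real unit_disc z *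
      ((1 - (cmod z)\<^sup>2) powr (p - 2) * cmod (of_real b / (1 - of_real b * z)) powr p))
      \<in> borel_measurable borel"
    by (intro borel_measurable_times borel_measurable_indicator) (simp, measurable)
  ultimately have meas [measurable]: "?d \<in> borel_measurable lborel"
    by simp
  have d0: "?d z \<ge> 0" for z by (simp add: besov_density_def)
  have E0: "E \<ge> 0" unfolding E_def using b p
    by (intro mult_nonneg_nonneg add_nonneg_nonneg ln_ge_zero) (auto simp: field_simps)
  have "(\<integral>\<^sup>+z. ennreal (?d z) \<partial>lborel)
      \<le> (\<integral>\<^sup>+z\<in>unit_disc. ennreal ((1 - (cmod z)\<^sup>2) powr (p - 2) *
             cmod (1 - of_real b * z) powr (- (p - 2 + 2))) \<partial>lborel)"
    using besov_density_log_kernel_le[OF b p]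
    by (intro nn_integral_mono) (auto simp: indicator_def intro!: ennreal_leI)
  also have "\<dots> \<le> ennreal E"
    using nn_integral_kernel_density_le[OF b, of "p - 2"] p by (simp add: E_def)
  finally have nn: "(\<integral>\<^sup>+z. ennreal (?d z) \<partial>lborel) \<le> ennreal E" .
  have int: "integrable lborel ?d"
    using nn d0 by (intro integrableI_nonneg[OF meas]) (auto intro: le_less_trans)
  then show "log_kernel b \<in> besov_space p"
    by (simp add: besov_space_def holomorphic_log_kernel[OF b] set_integrable_def)
  have "(LINT z:unit_disc|lborel. besov_density p (log_kernel b) z) \<le> E"
    unfolding set_lebesgue_integral_def
    using nn nn_integral_eq_integral[OF int] d0 E0 by (simp add: ennreal_le_iff)
  moreover have I0: "0 \<le> (LINT z:unit_disc|lborel. besov_density p (log_kernel b) z)"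
    unfolding set_lebesgue_integral_def using d0 by (intro Bochner_Integration.integral_nonneg)
  moreover have "1 / pi \<le> 1" using pi_gt3 by simp
  ultimately have "1 / pi * (LINT z:unit_disc|lborel. besov_density p (log_kernel b) z) \<le> E"
    using mult_mono[of "1 / pi" 1 "LINT z:unit_disc|lborel. besov_density p (log_kernel b) z" E] by auto
  moreover have "besov_norm p (log_kernel b)
      = (1 / pi * (LINT z:unit_disc|lborel. besov_density p (log_kernel b) z)) powr (1 / p)"
    using p I0 by (simp add: besov_norm_def besov_rho_def log_kernel_def powr_powr)
  ultimately show "besov_norm p (log_kernel b) \<le> E powr (1 / p)"
    using p I0 by (simp add: powr_mono2)
qed

section \<open>The image of a test function under the Hankel operator\<close>

lemma (in finite_measure) sums_integral_dominated:
  fixes f :: "nat \<Rightarrow> 'a \<Rightarrow> 'b :: {banach, second_countable_topology}"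
  assumes [measurable]: "\<And>i. f i \<in> borel_measurable M"
    and le: "\<And>i x. x \<in> space M \<Longrightarrow> norm (f i x) \<le> B i"
    and B: "summable B"
    and s: "\<And>x. x \<in> space M \<Longrightarrow> (\<lambda>i. f i x) sums g x"
  shows "integrable M g" and "(\<lambda>i. integral\<^sup>L M (f i)) sums integral\<^sup>L M g"
proof -
  have int: "integrable M (f i)" for i
    using le by (intro integrable_const_bound[where B = "B i"]) auto
  have 1: "AE x in M. summable (\<lambda>i. norm (f i x))"
    using le by (intro AE_I2 summable_comparison_test'[OF B]) auto
  have 2: "summable (\<lambda>i. \<integral>x. norm (f i x) \<partial>M)"
  proof (rule summable_comparison_test'[OF summable_mult[OF B, of "measure M (space M)"]])
    fix i
    have "(\<integral>x. norm (f i x) \<partial>M) \<le> (\<integral>x. B i \<partial>M)"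
      using le int by (intro integral_mono) auto
    then show "norm (\<integral>x. norm (f i x) \<partial>M) \<le> measure M (space M) * B i" by simp
  qed
  have eq: "(\<Sum>i. f i x) = g x" if "x \<in> space M" for x
    using s[OF that] by (simp add: sums_iff)
  show "integrable M g"
    using integrable_suminf[OF int 1 2] eq by (simp cong: Bochner_Integration.integrable_cong)
  show "(\<lambda>i. integral\<^sup>L M (f i)) sums integral\<^sup>L M g"
    using sums_integral[OF int 1 2] eq by (simp cong: Bochner_Integration.integral_cong)
qed

lemma borel_measure_01_space: "borel_measure_01 \<mu> \<Longrightarrow> space \<mu> = {0..<1}"
  using sets_eq_imp_space_eq[of \<mu> "restrict_space borel {0..<1}"]
  by (simp add: borel_measure_01_def space_restrict_space)

lemma borel_measure_01_measurable:
  assumes "borel_measure_01 \<mu>" "f \<in> measurable borel N"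
  shows "f \<in> measurable \<mu> N"
proof -
  have "f \<in> measurable (restrict_space borel {0..<1}) N"
    using assms(2) by (rule measurable_restrict_space1)
  then show ?thesis
    using assms(1) by (simp add: borel_measure_01_def cong: measurable_cong_sets)
qed

lemma neg_ln_one_minus_mult_bounds:
  fixes b t :: real
  assumes "0 \<le> b" "b < 1" "t \<in> {0..<1}"
  shows "0 \<le> - ln (1 - b * t)" and "- ln (1 - b * t) \<le> - ln (1 - b)"
proof -
  have "b * t \<le> b" "0 \<le> b * t" using assms mult_left_mono[of t 1 b] by auto
  then show "0 \<le> - ln (1 - b * t)" "- ln (1 - b * t) \<le> - ln (1 - b)"
    using assms by auto
qed

text \<open>
  Summing \<open>t ^ (n + k) * b ^ k / k\<close> over \<open>k\<close> under the integral sign gives the logarithm; the term for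
  \<open>k = 0\<close> vanishes, as division by 0 yields 0.
\<close>
lemma hankel_coeff_log_kernel:
  assumes \<mu>: "borel_measure_01 \<mu>" "finite_measure \<mu>" and b: "0 \<le> b" "b < 1"
  shows "hankel_coeff \<mu> (log_kernel b) n = of_real (\<integral>t. t ^ n * - ln (1 - b * t) \<partial>\<mu>)"
proof -
  interpret finite_measure \<mu> by fact
  have [measurable]: "(\<lambda>t. t) \<in> borel_measurable \<mu>"
    by (rule borel_measure_01_measurable[OF \<mu>(1)]) simp
  have "(\<lambda>k. \<integral>t. t ^ (n + k) * (b ^ k / real k) \<partial>\<mu>) sums (\<integral>t. t ^ n * - ln (1 - b * t) \<partial>\<mu>)"
  proof (rule sums_integral_dominated(2))
    show "summable (\<lambda>k. b ^ k)" using b by (simp add: summable_geometric)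
    fix t assume "t \<in> space \<mu>"
    then have t: "0 \<le> t" "t < 1" using borel_measure_01_space[OF \<mu>(1)] by auto
    show "norm (t ^ (n + k) * (b ^ k / real k)) \<le> b ^ k" for k
    proof -
      have "b ^ k / real k \<le> b ^ k"
        using b divide_left_mono[of 1 "real k" "b ^ k"] by (cases k) auto
      then have "t ^ (n + k) * (b ^ k / real k) \<le> 1 * b ^ k"
        using t b by (intro mult_mono power_le_one) auto
      then show ?thesis using t b by simp
    qed
    have "b * t < 1" using mult_strict_mono'[of b 1 t 1] b t by simp
    then have "\<bar>- (b * t)\<bar> < 1" using b t by simp
    from sums_mult[OF sums_minus[OF ln_series'[OF this]], of "t ^ n"]
    show "(\<lambda>k. t ^ (n + k) * (b ^ k / real k)) sums (t ^ n * - ln (1 - b * t))"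
      by (simp add: power_mult_distrib power_add mult_ac)
  qed measurable
  from sums_of_real[OF this, where 'a = complex]
  have "(\<lambda>k. of_real (moment \<mu> (n + k)) * taylor_coeff (log_kernel b) k) sums
      complex_of_real (\<integral>t. t ^ n * - ln (1 - b * t) \<partial>\<mu>)"
    by (simp add: taylor_coeff_log_kernel[OF b] moment_def)
  then show ?thesis by (simp add: hankel_coeff_def sums_iff)
qed

text \<open>
  Formally, the operator sends \<open>f\<close> to the integral of \<open>f t / (1 - t z)\<close> with respect to \<open>\<mu>\<close>; this is the
  derivative of that formula for \<open>f = log_kernel b\<close>, obtained by termwise differentiation of the power
  series. As \<open>f\<close> is bounded on \<open>[0, 1)\<close>, the interchange of sum and integral is dominated for each \<open>z\<close>
  in the disc.
\<close>
lemma hankel_op_log_kernel_deriv: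
  assumes \<mu>: "borel_measure_01 \<mu>" "finite_measure \<mu>" and b: "0 \<le> b" "b < 1"
    and wd: "hankel_well_defined \<mu> (log_kernel b)" and z: "cmod z < 1"
  defines "G \<equiv> \<lambda>t. of_real (t * - ln (1 - b * t)) / (1 - of_real t * z)\<^sup>2"
  shows "integrable \<mu> G" and "deriv (hankel_op \<mu> (log_kernel b)) z = (\<integral>t. G t \<partial>\<mu>)"
proof -
  interpret finite_measure \<mu> by fact
  have [measurable]: "(\<lambda>t. t) \<in> borel_measurable \<mu>"
    by (rule borel_measure_01_measurable[OF \<mu>(1)]) simp
  let ?c = "hankel_coeff \<mu> (log_kernel b)"
  let ?f = "\<lambda>n t. of_real (t ^ Suc n * - ln (1 - b * t)) * (of_nat (Suc n) * z ^ n) :: complex"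
  have "summable (\<lambda>n. of_nat (Suc n) * cmod z ^ n)"
    using geometric_deriv_sums[of "cmod z"] z by (simp add: sums_iff)
  then have B: "summable (\<lambda>n. - ln (1 - b) * (of_nat (Suc n) * cmod z ^ n))"
    by (rule summable_mult)
  have le: "cmod (?f n t) \<le> - ln (1 - b) * (of_nat (Suc n) * cmod z ^ n)"
    if "t \<in> space \<mu>" for n t
  proof -
    have t: "t \<in> {0..<1}" using that borel_measure_01_space[OF \<mu>(1)] by simp
    have "t ^ Suc n * - ln (1 - b * t) \<le> 1 * - ln (1 - b)"
      using neg_ln_one_minus_mult_bounds[OF b t] t by (intro mult_mono power_le_one) auto
    moreover have "0 \<le> t ^ Suc n * - ln (1 - b * t)"
      using neg_ln_one_minus_mult_bounds[OF b t] t by (intro mult_nonneg_nonneg) auto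
    ultimately have "\<bar>t ^ Suc n * - ln (1 - b * t)\<bar> \<le> - ln (1 - b)" by linarith
    moreover have "cmod (?f n t)
        = \<bar>t ^ Suc n * - ln (1 - b * t)\<bar> * (of_nat (Suc n) * cmod z ^ n)"
      by (simp only: norm_mult norm_of_real norm_power norm_of_nat)
    ultimately show ?thesis
      by (simp only:) (intro mult_right_mono, auto)
  qed
  have s: "(\<lambda>n. ?f n t) sums G t" if "t \<in> space \<mu>" for t
  proof -
    have t: "0 \<le> t" "t < 1" using that borel_measure_01_space[OF \<mu>(1)] by auto
    have "(\<lambda>n. of_nat (Suc n) * (of_real t * z) ^ n) sums (1 / (1 - of_real t * z)\<^sup>2)"
      by (intro geometric_deriv_sums cmod_of_real_mult_less_one t z)
    from sums_mult[OF this, of "of_real (t * - ln (1 - b * t))"]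
    show ?thesis by (simp add: G_def power_mult_distrib mult_ac del: of_nat_Suc)
  qed
  note swap = sums_integral_dominated[of ?f, OF _ le B s]
  show "integrable \<mu> G" by (rule swap(1)) measurable
  have "(\<lambda>n. \<integral>t. ?f n t \<partial>\<mu>) sums (\<integral>t. G t \<partial>\<mu>)" by (rule swap(2)) measurable
  also have "(\<lambda>n. \<integral>t. ?f n t \<partial>\<mu>) = (\<lambda>n. ?c (Suc n) * (of_nat (Suc n) * z ^ n))"
    unfolding hankel_coeff_log_kernel[OF \<mu> b]
    by (simp only: integral_mult_left_zero integral_complex_of_real)
  also have "\<dots> = (\<lambda>n. diffs ?c n * z ^ n)"
    by (simp add: diffs_def mult_ac del: of_nat_Suc)
  finally have "(\<Sum>n. diffs ?c n * z ^ n) = (\<integral>t. G t \<partial>\<mu>)" by (simp add: sums_iff)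
  moreover have "((\<lambda>z. \<Sum>n. ?c n * z ^ n) has_field_derivative (\<Sum>n. diffs ?c n * z ^ n)) (at z)"
    using wd z by (intro termdiffs_strong'[where K = 1]) (auto simp: hankel_well_defined_def)
  ultimately show "deriv (hankel_op \<mu> (log_kernel b)) z = (\<integral>t. G t \<partial>\<mu>)"
    unfolding hankel_op_def[abs_def] by (intro DERIV_imp_deriv) simp
qed

text \<open>
  In the sector \<open>\<bar>Im w\<bar> \<le> Re w / 2\<close> the argument of \<open>w\<^sup>2\<close> stays away from a right angle.
\<close>
lemma Re_inverse_square_ge:
  fixes w :: complex
  assumes "0 < Re w" "\<bar>Im w\<bar> \<le> Re w / 2"
  shows "2 / (5 * (Re w)\<^sup>2) \<le> Re (1 / w\<^sup>2)"
proof -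
  define U V where "U = (Re w)\<^sup>2" and "V = (Im w)\<^sup>2"
  have U: "U > 0" and V: "V \<ge> 0" using assms by (auto simp: U_def V_def)
  have VU: "4 * V \<le> U"
    using power_mono[OF assms(2), of 2] by (simp add: U_def V_def power_divide)
  have "Re (1 / w\<^sup>2) = (U - V) / (U + V)\<^sup>2"
  proof -
    have "Re (w\<^sup>2) = U - V" and "(Re (w\<^sup>2))\<^sup>2 + (Im (w\<^sup>2))\<^sup>2 = (U + V)\<^sup>2"
      by (simp_all add: U_def V_def power2_eq_square algebra_simps)
    then show ?thesis by (simp add: Re_divide)
  qed
  moreover have "2 / (5 * U) \<le> (U - V) / (U + V)\<^sup>2"
  proof -
    have "U * (4 * V) \<le> U * U" "V * (4 * V) \<le> U * U"
      using VU U V by (auto intro!: mult_left_mono mult_mono)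
    then have "4 * (U * V) \<le> U * U" "4 * (V * V) \<le> U * U" by simp_all
    moreover have "0 \<le> U * U" by simp
    ultimately have "9 * (U * V) + 2 * (V * V) \<le> 3 * (U * U)" by linarith
    then have "2 * (U + V)\<^sup>2 \<le> (U - V) * (5 * U)"
      by (simp add: power2_eq_square algebra_simps)
    then show ?thesis using U V by (simp add: divide_le_eq le_divide_eq frac_le_eq field_simps)
  qed
  ultimately show ?thesis by (simp add: U_def)
qed

text \<open>
  The box has side of order \<open>1 - b\<close>, and so flat that \<open>1 - t z\<close> stays in the sector
  \<open>\<bar>Im w\<bar> \<le> Re w / 2\<close> for all \<open>t\<close> in \<open>[0, 1)\<close>. Therefore the integrand for the derivative has nonnegative
  real part, no cancellation occurs, and the integral may be restricted to \<open>t \<ge> b\<close>. There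
  \<open>\<bar>1 - t z\<bar>\<close> is of order \<open>1 - b\<close>, and the logarithm \<open>- ln (1 - b t)\<close> is comparable to \<open>ln (2 / (1 - b))\<close>.
\<close>
lemma hankel_op_log_kernel_deriv_ge:
  assumes \<mu>: "borel_measure_01 \<mu>" "finite_measure \<mu>" and b: "7 / 8 \<le> b" "b < 1"
    and wd: "hankel_well_defined \<mu> (log_kernel b)"
    and z: "z \<in> cbox (Complex b (- (1 - b) / 4)) (Complex (1 - (1 - b) / 2) ((1 - b) / 4))"
  shows "ln (2 / (1 - b)) * measure \<mu> {b..<1} / (40 * (1 - b)\<^sup>2)
      \<le> cmod (deriv (hankel_op \<mu> (log_kernel b)) z)"
proof -
  interpret finite_measure \<mu> by fact
  define \<delta> where "\<delta> = 1 - b"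
  have \<delta>: "0 < \<delta>" "\<delta> \<le> 1 / 8" and b_eq: "b = 1 - \<delta>" using b by (auto simp: \<delta>_def)
  have b01: "0 \<le> b" using b by simp
  have x: "1 - \<delta> \<le> Re z" "Re z \<le> 1 - \<delta> / 2" and y: "\<bar>Im z\<bar> \<le> \<delta> / 4"
    using z by (auto simp: cbox_def Basis_complex_def b_eq)
  have zlt: "cmod z < 1" using cmod_le[of z] x y \<delta> by simp
  define G where "G = (\<lambda>t. of_real (t * - ln (1 - b * t)) / (1 - of_real t * z)\<^sup>2)"
  note G = hankel_op_log_kernel_deriv[OF \<mu> b01 b(2) wd zlt, folded G_def]
  define c where "c = ln (2 / \<delta>) / (40 * \<delta>\<^sup>2)"
  have "indicator {b..<1} t * c \<le> Re (G t)" if "t \<in> space \<mu>" for t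
  proof -
    have t: "0 \<le> t" "t < 1" and t': "t \<in> {0..<1}"
      using that borel_measure_01_space[OF \<mu>(1)] by auto
    define w where "w = 1 - of_real t * z"
    have tx: "t * Re z \<le> Re z" using t x \<delta> mult_right_mono[of t 1 "Re z"] by simp
    have ty: "t * \<bar>Im z\<bar> \<le> \<bar>Im z\<bar>" using t mult_right_mono[of t 1 "\<bar>Im z\<bar>"] by simp
    have "t * Re z < 1" using tx x \<delta> by linarith
    then have Rw: "0 < Re w" by (simp add: w_def)
    have "\<delta> / 2 \<le> 1 - t * Re z" using tx x by linarith
    then have "\<delta> / 4 \<le> (1 - t * Re z) / 2" by simp
    with ty y have "t * \<bar>Im z\<bar> \<le> (1 - t * Re z) / 2" by (meson order_trans)
    then have Iw: "\<bar>Im w\<bar> \<le> Re w / 2" using t by (simp add: w_def abs_mult)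
    have Re_w: "2 / (5 * (Re w)\<^sup>2) \<le> Re (1 / w\<^sup>2)" by (rule Re_inverse_square_ge[OF Rw Iw])
    have \<phi>: "0 \<le> - ln (1 - b * t)" by (rule neg_ln_one_minus_mult_bounds[OF b01 b(2) t'])
    have "G t = of_real (t * - ln (1 - b * t)) * (1 / w\<^sup>2)"
      by (simp add: G_def w_def)
    then have Re_G: "Re (G t) = t * - ln (1 - b * t) * Re (1 / w\<^sup>2)"
      by (simp only: scaleR_conv_of_real[symmetric] scaleR_complex.sel)
    show ?thesis
    proof (cases "b \<le> t")
      case False
      have "0 \<le> Re (1 / w\<^sup>2)" using Re_w by (rule order_trans[rotated]) simp
      then have "0 \<le> Re (G t)"
        unfolding Re_G using t \<phi> by (intro mult_nonneg_nonneg) auto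
      then show ?thesis using False by simp
    next
      case True
      have bt: "b * b \<le> b * t" using True b01 by (rule mult_left_mono)
      have bb: "1 - b * b \<le> 2 * \<delta>" by (simp add: b_eq algebra_simps)
      have "b * b \<le> t * Re z" using True x b01 by (intro mult_mono) (auto simp: b_eq)
      then have "Re w \<le> 2 * \<delta>" using bb by (simp add: w_def)
      then have "(Re w)\<^sup>2 \<le> (2 * \<delta>)\<^sup>2" using Rw by (intro power_mono) auto
      then have "2 / (5 * (2 * \<delta>)\<^sup>2) \<le> 2 / (5 * (Re w)\<^sup>2)"
        using Rw \<delta> by (intro divide_left_mono) auto
      then have 1: "1 / (10 * \<delta>\<^sup>2) \<le> Re (1 / w\<^sup>2)"
        using Re_w by (simp add: power_mult_distrib)
      have bt1: "b * t < 1" using mult_strict_mono'[of b 1 t 1] b01 b t by simp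
      \<comment> \<open>\<open>\<delta> \<le> 1 / 8\<close> makes \<open>ln (1 / (2 * \<delta>))\<close> at least half of \<open>ln (2 / \<delta>)\<close>.\<close>
      have "ln (1 - b * t) \<le> ln (2 * \<delta>)" using bt bb bt1 by (intro ln_mono) auto
      also have "\<dots> = ln 2 + ln \<delta>" using \<delta> by (simp add: ln_mult)
      finally have l: "- ln 2 - ln \<delta> \<le> - ln (1 - b * t)" by simp
      have "ln \<delta> \<le> ln (1 / 8)" using \<delta> by (intro ln_mono) auto
      also have "\<dots> = - 3 * ln (2 :: real)"
        using ln_realpow[of 2 3] by (simp add: ln_div)
      finally have l8: "ln \<delta> \<le> - 3 * ln 2" .
      have L: "ln (2 / \<delta>) = ln 2 - ln \<delta>" using \<delta> by (simp add: ln_div)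
      have L0: "0 \<le> ln (2 / \<delta>)" using \<delta> by (intro ln_ge_zero) (auto simp: field_simps)
      have 2: "ln (2 / \<delta>) / 2 \<le> - ln (1 - b * t)" using l l8 L by simp
      have "(1 / 2) * (ln (2 / \<delta>) / 2) * (1 / (10 * \<delta>\<^sup>2)) \<le> t * - ln (1 - b * t) * Re (1 / w\<^sup>2)"
        using 1 2 True b t \<phi> L0 mult_nonneg_nonneg[OF t(1) \<phi>] by (intro mult_mono) auto
      then show ?thesis
        unfolding Re_G using True t by (simp add: c_def field_simps)
    qed
  qed
  moreover have "{b..<1} \<in> sets \<mu>"
    using \<mu>(1) b01 by (auto simp: borel_measure_01_def sets_restrict_space_iff)
  ultimately have "(\<integral>t. indicator {b..<1} t * c \<partial>\<mu>) \<le> (\<integral>t. Re (G t) \<partial>\<mu>)"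
    using G(1) by (intro integral_mono integrable_mult_left integrable_real_indicator)
      (auto simp: emeasure_eq_measure)
  also have "(\<integral>t. Re (G t) \<partial>\<mu>) = Re (\<integral>t. G t \<partial>\<mu>)" using G(1) by simp
  also have "\<dots> \<le> cmod (deriv (hankel_op \<mu> (log_kernel b)) z)"
    unfolding G(2) by (rule complex_Re_le_cmod)
  also have "(\<integral>t. indicator {b..<1} t * c \<partial>\<mu>) = measure \<mu> {b..<1} * c"
    using \<open>{b..<1} \<in> sets \<mu>\<close> sets.sets_into_space[OF \<open>{b..<1} \<in> sets \<mu>\<close>]
    by (simp add: Int_absorb1 Int_absorb2)
  finally show ?thesis by (simp add: c_def \<delta>_def mult_ac)
qed

section \<open>From boundedness to the Carleson condition\<close>

text \<open>
  On the box the weight \<open>(1 - \<bar>z\<bar>\<^sup>2) powr (p - 2)\<close> is of order \<open>\<delta> powr (p - 2)\<close>, and the area of the box is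
  \<open>\<delta>\<^sup>2 / 4\<close>; together they contribute \<open>\<delta> powr p\<close>, whose \<open>p\<close>-th root is the factor \<open>\<delta>\<close> in front of \<open>A\<close>.
  The bound \<open>\<delta> / 4 \<le> 1 - \<bar>z\<bar>\<^sup>2 \<le> 4 \<delta>\<close> is two-sided because \<open>p - 2\<close> may have either sign.
\<close>
lemma besov_norm_ge_of_deriv_ge_on_box:
  fixes A \<delta> p :: real
  assumes p: "1 < p" and \<delta>: "0 < \<delta>" "\<delta> \<le> 1" and A: "0 \<le> A" and g: "g \<in> besov_space p"
    and ge: "\<And>z. z \<in> cbox (Complex (1 - \<delta>) (- \<delta> / 4)) (Complex (1 - \<delta> / 2) (\<delta> / 4))
               \<Longrightarrow> A \<le> cmod (deriv g z)"
  shows "(4 powr (- \<bar>p - 2\<bar>) / (4 * pi)) powr (1 / p) * (\<delta> * A) \<le> besov_norm p g"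
proof -
  let ?B = "cbox (Complex (1 - \<delta>) (- \<delta> / 4)) (Complex (1 - \<delta> / 2) (\<delta> / 4))"
  define c where "c = 4 powr (- \<bar>p - 2\<bar>) * \<delta> powr (p - 2) * A powr p"
  define I where "I = (LINT z:unit_disc|lborel. besov_density p g z)"
  have int: "integrable lborel (\<lambda>z. indicator unit_disc z *\<^sub>R besov_density p g z)"
    using g by (simp add: besov_space_def set_integrable_def)
  have le: "indicator ?B z * c \<le> indicator unit_disc z *\<^sub>R besov_density p g z" for z
  proof (cases "z \<in> ?B")
    case False
    then show ?thesis by (simp add: besov_density_def)
  next
    case True
    have x: "1 - \<delta> \<le> Re z" "Re z \<le> 1 - \<delta> / 2" and y: "\<bar>Im z\<bar> \<le> \<delta> / 4"
      using True by (auto simp: cbox_def Basis_complex_def)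
    have z1: "cmod z \<le> 1 - \<delta> / 4" using cmod_le[of z] x y \<delta> by simp
    define v where "v = 1 - (cmod z)\<^sup>2"
    have v_eq: "v = (1 - cmod z) * (1 + cmod z)" by (simp add: v_def power2_eq_square algebra_simps)
    have "(1 - cmod z) * 1 \<le> v" unfolding v_eq using z1 \<delta> by (intro mult_left_mono) auto
    then have v1: "\<delta> / 4 \<le> v" using z1 by simp
    have "1 - cmod z \<le> \<delta>" using x complex_Re_le_cmod[of z] by simp
    then have "v \<le> \<delta> * 4" unfolding v_eq using z1 \<delta> by (intro mult_mono) auto
    have "4 powr (- \<bar>p - 2\<bar>) * \<delta> powr (p - 2) \<le> v powr (p - 2)"
    proof (cases "p \<ge> 2")
      case True
      then have "4 powr (- \<bar>p - 2\<bar>) * \<delta> powr (p - 2) = (\<delta> / 4) powr (p - 2)"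
        using \<delta> by (simp only: powr_divide powr_minus_divide) simp
      also have "\<dots> \<le> v powr (p - 2)" using True v1 \<delta> by (intro powr_mono2) auto
      finally show ?thesis .
    next
      case False
      then have "4 powr (- \<bar>p - 2\<bar>) * \<delta> powr (p - 2) = (\<delta> * 4) powr (p - 2)"
        using \<delta> by (simp add: powr_mult)
      also have "\<dots> \<le> v powr (p - 2)"
        using False v1 \<open>v \<le> \<delta> * 4\<close> \<delta> by (intro powr_mono2') auto
      finally show ?thesis .
    qed
    moreover have "A powr p \<le> cmod (deriv g z) powr p"
      using ge[OF True] A p by (intro powr_mono2) auto
    ultimately have "c \<le> besov_density p g z"
      unfolding c_def besov_density_def v_def by (intro mult_mono) auto
    moreover have "z \<in> unit_disc" using z1 \<delta> by simp
    ultimately show ?thesis using True by simp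
  qed
  have em: "emeasure lborel ?B = ennreal (\<delta>\<^sup>2 / 4)"
    using \<delta> by (subst emeasure_lborel_cbox_eq) (auto simp: Basis_complex_def power2_eq_square field_simps)
  have "(\<integral>z. indicator ?B z * c \<partial>lborel) \<le> I"
    unfolding I_def set_lebesgue_integral_def
    by (intro integral_mono[OF _ int le] integrable_mult_left integrable_real_indicator)
       (simp_all add: emeasure_lborel_cbox_finite[unfolded infinity_ennreal_def])
  also have "(\<integral>z. indicator ?B z * c \<partial>lborel) = \<delta>\<^sup>2 / 4 * c"
    using em by (simp add: measure_def)
  also have "\<delta>\<^sup>2 / 4 * c = 4 powr (- \<bar>p - 2\<bar>) / 4 * (\<delta> * A) powr p"
  proof -
    have "\<delta>\<^sup>2 * \<delta> powr (p - 2) = \<delta> powr p"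
      using \<delta> by (simp add: powr_diff)
    then show ?thesis using \<delta> A by (simp add: c_def powr_mult)
  qed
  finally have I: "4 powr (- \<bar>p - 2\<bar>) / (4 * pi) * (\<delta> * A) powr p \<le> 1 / pi * I"
    by (simp add: field_simps)
  have I0: "0 \<le> 1 / pi * I"
    by (rule order_trans[OF _ I]) simp
  have "(4 powr (- \<bar>p - 2\<bar>) / (4 * pi)) powr (1 / p) * (\<delta> * A)
      = (4 powr (- \<bar>p - 2\<bar>) / (4 * pi) * (\<delta> * A) powr p) powr (1 / p)"
  proof -
    have "((\<delta> * A) powr p) powr (1 / p) = \<delta> * A"
      using p \<delta> A by (simp add: powr_powr)
    then show ?thesis by (simp only: powr_mult[where y = "(\<delta> * A) powr p"])
  qed
  also have "\<dots> \<le> (1 / pi * I) powr (1 / p)"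
    using I p by (intro powr_mono2) auto
  also have "\<dots> = besov_rho p g" by (simp add: besov_rho_def I_def)
  also have "\<dots> = (besov_rho p g powr p) powr (1 / p)"
  proof -
    have "0 \<le> besov_rho p g" by (simp add: besov_rho_def)
    then show ?thesis using p by (simp add: powr_powr)
  qed
  also have "\<dots> \<le> besov_norm p g"
    unfolding besov_norm_def using p by (intro powr_mono2) auto
  finally show ?thesis .
qed

text \<open>
  Write \<open>\<delta> = 1 - b\<close>, \<open>L = ln (2 / \<delta>)\<close> and \<open>m\<close> for the mass of \<open>[b, 1)\<close>. The image of the test function has
  norm at least a multiple of \<open>L m / \<delta>\<close>, while the test function has norm at most a multiple of
  \<open>L powr (1 / p)\<close>. Boundedness compares the two, and dividing by \<open>L powr (1 / p)\<close> gives the claim.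
\<close>
lemma hankel_bounded_besov_log_growth:
  assumes p: "1 < p" and \<mu>: "borel_measure_01 \<mu>" "finite_measure \<mu>"
    and bdd: "hankel_bounded_besov p \<mu>"
  obtains D where "D > 0"
    and "\<And>b. 7 / 8 \<le> b \<Longrightarrow> b < 1 \<Longrightarrow>
           measure \<mu> {b..<1} * ln (2 / (1 - b)) powr (1 - 1 / p) \<le> D * (1 - b)"
proof -
  obtain C0 where C0: "\<And>f. f \<in> besov_space p \<Longrightarrow> besov_norm p (hankel_op \<mu> f) \<le> C0 * besov_norm p f"
    using bdd by (auto simp: hankel_bounded_besov_def)
  \<comment> \<open>A nonnegative constant, so that it may be multiplied by an upper bound of the norm.\<close>
  define C where "C = max C0 0"
  define K where "K = 2 powr \<bar>p - 2\<bar> * 5 powr p * (2 / (p - 1)) * 12"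
  define k where "k = (4 powr (- \<bar>p - 2\<bar>) / (4 * pi)) powr (1 / p)"
  define D where "D = 40 * (C * K powr (1 / p)) / k + 1"
  have k: "k > 0" by (simp add: k_def)
  have C: "C \<ge> 0" by (simp add: C_def)
  have D: "D > 0" using C k by (auto simp: D_def intro!: add_nonneg_pos divide_nonneg_pos)
  have "measure \<mu> {b..<1} * ln (2 / (1 - b)) powr (1 - 1 / p) \<le> D * (1 - b)"
    if b: "7 / 8 \<le> b" "b < 1" for b
  proof -
    have b0: "0 \<le> b" using b by simp
    define \<delta> L m where "\<delta> = 1 - b" and "L = ln (2 / \<delta>)" and "m = measure \<mu> {b..<1}"
    have \<delta>: "0 < \<delta>" "\<delta> \<le> 1" and b_eq: "b = 1 - \<delta>" using b by (auto simp: \<delta>_def)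
    have "exp 1 \<le> 2 / \<delta>"
      using exp_le b by (rule_tac order_trans) (auto simp: \<delta>_def field_simps)
    then have L1: "L \<ge> 1" unfolding L_def using \<delta> by (subst ln_ge_iff) auto
    have m: "m \<ge> 0" by (simp add: m_def)
    let ?f = "log_kernel b" and ?g = "hankel_op \<mu> (log_kernel b)"
    note f = log_kernel_besov[OF b0 b(2) p]
    have wd: "hankel_well_defined \<mu> ?f" and g: "?g \<in> besov_space p"
      using bdd f(1) by (auto simp: hankel_bounded_besov_def)
    have "k * (\<delta> * (L * m / (40 * \<delta>\<^sup>2))) \<le> besov_norm p ?g"
      unfolding k_def
    proof (rule besov_norm_ge_of_deriv_ge_on_box[OF p \<delta> _ g])
      fix z assume "z \<in> cbox (Complex (1 - \<delta>) (- \<delta> / 4)) (Complex (1 - \<delta> / 2) (\<delta> / 4))"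
      then show "L * m / (40 * \<delta>\<^sup>2) \<le> cmod (deriv ?g z)"
        using hankel_op_log_kernel_deriv_ge[OF \<mu> b wd, of z]
        by (simp add: L_def m_def \<delta>_def)
    qed (use L1 m in simp)
    also have "\<dots> \<le> C0 * besov_norm p ?f" by (rule C0[OF f(1)])
    also have "\<dots> \<le> C * besov_norm p ?f"
      by (intro mult_right_mono) (auto simp: C_def besov_norm_def)
    also have "besov_norm p ?f \<le> (K * L) powr (1 / p)"
    proof (rule order_trans[OF f(2)], rule powr_mono2)
      have "ln ((2 - b) / (1 - b)) \<le> L"
        unfolding L_def \<delta>_def using b by (intro ln_mono divide_right_mono) auto
      moreover have "2 * pi \<le> 8 * L" using L1 pi_less_4 by simp
      ultimately have *: "4 * ln ((2 - b) / (1 - b)) + 2 * pi \<le> 12 * L" by simp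
      have "2 powr \<bar>p - 2\<bar> * 5 powr p * (2 / (p - 1)) * (4 * ln ((2 - b) / (1 - b)) + 2 * pi)
          \<le> 2 powr \<bar>p - 2\<bar> * 5 powr p * (2 / (p - 1)) * (12 * L)"
        using p by (intro mult_left_mono[OF *]) auto
      then show "2 powr \<bar>p - 2\<bar> * 5 powr p * (2 / (p - 1)) * (4 * ln ((2 - b) / (1 - b)) + 2 * pi)
          \<le> K * L" by (simp add: K_def mult_ac)
      have "0 \<le> ln ((2 - b) / (1 - b))" using b by (intro ln_ge_zero) (auto simp: field_simps)
      then show "0 \<le> 2 powr \<bar>p - 2\<bar> * 5 powr p * (2 / (p - 1)) * (4 * ln ((2 - b) / (1 - b)) + 2 * pi)"
        using p by (intro mult_nonneg_nonneg add_nonneg_nonneg) auto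
    qed (use p in auto)
    also have "(K * L) powr (1 / p) = K powr (1 / p) * L powr (1 / p)"
      by (rule powr_mult)
    finally have main: "k * (\<delta> * (L * m / (40 * \<delta>\<^sup>2))) \<le> C * (K powr (1 / p) * L powr (1 / p))"
      using C by (simp add: mult_left_mono)
    have "k * (\<delta> * (L * m / (40 * \<delta>\<^sup>2))) = (m * L powr (1 - 1 / p)) * (L powr (1 / p) * k / (40 * \<delta>))"
      using L1 \<delta> by (simp add: powr_diff power2_eq_square field_simps)
    with main have "(m * L powr (1 - 1 / p)) * (k / (40 * \<delta>)) * L powr (1 / p)
        \<le> C * K powr (1 / p) * L powr (1 / p)" by (simp add: mult_ac)
    then have "(m * L powr (1 - 1 / p)) * (k / (40 * \<delta>)) \<le> C * K powr (1 / p)"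
      by (rule mult_right_le_imp_le) (use L1 in simp)
    then have "m * L powr (1 - 1 / p) \<le> 40 * (C * K powr (1 / p)) / k * \<delta>"
      using k \<delta> by (simp add: field_simps)
    also have "\<dots> \<le> D * \<delta>" using \<delta> by (intro mult_right_mono) (auto simp: D_def)
    finally show ?thesis by (simp add: m_def L_def \<delta>_def)
  qed
  with D that show ?thesis by blast
qed

theorem theorem3p7:
  fixes p \<gamma> :: real and \<mu> :: "real measure"
  assumes "1 < p"
    and "borel_measure_01 \<mu>" and "finite_measure \<mu>"
    and "hankel_bounded_besov p \<mu>"
    and "0 \<le> \<gamma>" and "\<gamma> < 1 - 1 / p"
  shows "log_carleson \<gamma> 1 \<mu>"
proof -
  interpret finite_measure \<mu> by fact
  obtain D where D: "D > 0" and le: "\<And>b. 7 / 8 \<le> b \<Longrightarrow> b < 1 \<Longrightarrow>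
      measure \<mu> {b..<1} * ln (2 / (1 - b)) powr (1 - 1 / p) \<le> D * (1 - b)"
    using hankel_bounded_besov_log_growth[OF assms(1-4)] by blast
  \<comment> \<open>For \<open>t < 7 / 8\<close> the logarithm is at most \<open>ln 16\<close> and \<open>1 - t\<close> exceeds \<open>1 / 8\<close>.\<close>
  define E where "E = 8 * (measure \<mu> (space \<mu>) * ln 16 powr \<gamma>)"
  have E: "E \<ge> 0" by (simp add: E_def)
  have "measure \<mu> {t..<1} * ln (2 / (1 - t)) powr \<gamma> \<le> (D + E) * (1 - t)"
    if t: "0 \<le> t" "t < 1" for t
  proof (cases "7 / 8 \<le> t")
    case True
    have "exp 1 \<le> 2 / (1 - t)"
      using exp_le True t by (rule_tac order_trans) (auto simp: field_simps)
    then have "1 \<le> ln (2 / (1 - t))" using t by (subst ln_ge_iff) auto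
    then have "measure \<mu> {t..<1} * ln (2 / (1 - t)) powr \<gamma>
        \<le> measure \<mu> {t..<1} * ln (2 / (1 - t)) powr (1 - 1 / p)"
      using assms(6) by (intro mult_left_mono powr_mono) auto
    also have "\<dots> \<le> D * (1 - t)" by (rule le[OF True t(2)])
    also have "\<dots> \<le> (D + E) * (1 - t)" using E t by (intro mult_right_mono) auto
    finally show ?thesis .
  next
    case False
    have "0 \<le> ln (2 / (1 - t))" using t by (intro ln_ge_zero) (auto simp: field_simps)
    moreover have "ln (2 / (1 - t)) \<le> ln 16"
      using False t by (intro ln_mono) (auto simp: field_simps)
    ultimately have "measure \<mu> {t..<1} * ln (2 / (1 - t)) powr \<gamma> \<le> E / 8"
      using assms(5) bounded_measure[of "{t..<1}"]
      by (auto simp: E_def intro!: mult_mono powr_mono2)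
    also have "\<dots> \<le> E * (1 - t)"
      using False E mult_left_mono[of "1 / 8" "1 - t" E] by simp
    also have "\<dots> \<le> (D + E) * (1 - t)" using D t by (intro mult_right_mono) auto
    finally show ?thesis .
  qed
  then have "\<forall>t\<in>{0..<1}. emeasure \<mu> {t..<1} * ennreal (ln (2 / (1 - t)) powr \<gamma>)
      \<le> ennreal ((D + E) * (1 - t) powr 1)"
    by (auto simp: emeasure_eq_measure ennreal_leI simp flip: ennreal_mult')
  moreover have "D + E > 0" using D E by simp
  ultimately show ?thesis
    using assms(2) unfolding log_carleson_def by blast
qed

end
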